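(* Let $k$ be a field, $V$ a finite-dimensional $k$-vector space and $b:V\times V\to k$ an anisotropic symmetric $k$-bilinear form. Then $\mathrm{PU}(b)=\mathrm{PPU}(b)\rtimes U(b)$ (internal semidirect product with normal subgroup $\mathrm{PPU}(b)$), where $U(b)$ is identified with the subgroup of constants $\{t^0\varphi:\varphi\in U(b)\}$ of $\mathrm{PU}(b)$.
   Context: Anisotropic means $b(v,v)=0\Leftrightarrow v=0$. $U(b)$ is the group of $k$-linear maps $\varphi:V\to V$ with $b(\varphi(v),\varphi(w))=b(v,w)$ for all $v,w\in V$. Let $V[t,t^{-1}]:=k[t,t^{-1}]\otimes_k V$; its elements are finite sums $v=\sum_{i\in\mathbb Z}t^iv_i$ with $v_i\in V$. Define $\tilde b(v,w)=\sum_{n\in\mathbb Z} t^n\big(\sum_{i\in\mathbb Z} b(v_{i-n},w_i)\big)\in k[t,t^{-1}]$. Each $\varphi\in \mathrm{End}_{k[t,t^{-1}]}V[t,t^{-1}]$ is uniquely a finite sum $\varphi=\sum_i t^i\varphi_i$ with $\varphi_i\in\mathrm{End}_kV$; put $\varphi(1)=\sum_i\varphi_i$. The paraunitary group $\mathrm{PU}(b)$ is the group of all $k[t,t^{-1}]$-linear automorphisms $\varphi$ of $V[t,t^{-1}]$ with $\tilde b(\varphi(v),\varphi(w))=\tilde b(v,w)$ for all $v,w$. The pure paraunitary group $\mathrm{PPU}(b)$ is the kernel of the specialization homomorphism $\varepsilon_1:\mathrm{PU}(b)\to U(b)$, $\varphi\mapsto\varphi(1)$. *)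

theory Defs
  imports Complex_Main "HOL-Library.Poly_Mapping" "HOL-Algebra.Coset"
begin

text \<open>
  The type \<open>int \<Rightarrow>\<^sub>0 'k\<close> with its convolution product is the ring of Laurent polynomials over \<open>'k\<close>,
  and \<open>int \<Rightarrow>\<^sub>0 'v\<close> is the Laurent module over the space \<open>'v\<close>: the map \<open>v\<close> stands for the finite sum of
  the \<open>t\<^sup>i v\<^sub>i\<close> with \<open>v\<^sub>i = Poly_Mapping.lookup v i\<close>, and \<open>single i u\<close> for \<open>t\<^sup>i u\<close>.
\<close>

definition laurent_scale ::
    "('k::field \<Rightarrow> 'v::ab_group_add \<Rightarrow> 'v) \<Rightarrow> (int \<Rightarrow>\<^sub>0 'k) \<Rightarrow> (int \<Rightarrow>\<^sub>0 'v) \<Rightarrow> (int \<Rightarrow>\<^sub>0 'v)" where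
  "laurent_scale scale f v =
     (\<Sum>i\<in>Poly_Mapping.keys f. \<Sum>j\<in>Poly_Mapping.keys v. Poly_Mapping.single (i + j) (scale (Poly_Mapping.lookup f i) (Poly_Mapping.lookup v j)))"

text \<open>\<^const>\<open>Sum_any\<close> is the sum over the support, and is \<open>0\<close> if the support is infinite; for biadditive \<open>b\<close>
  both supports below are finite, see \<open>lookup_laurent_form\<close>.\<close>

definition laurent_form ::
    "('v \<Rightarrow> 'v \<Rightarrow> 'k::field) \<Rightarrow> (int \<Rightarrow>\<^sub>0 'v::ab_group_add) \<Rightarrow> (int \<Rightarrow>\<^sub>0 'v) \<Rightarrow> (int \<Rightarrow>\<^sub>0 'k)" where
  "laurent_form b v w =
     Sum_any (\<lambda>n. Poly_Mapping.single n
       (Sum_any (\<lambda>i. b (Poly_Mapping.lookup v (i - n)) (Poly_Mapping.lookup w i))))"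

text \<open>The endomorphism \<open>t\<^sup>i g\<close> for an endomorphism \<open>g\<close> of \<open>'v\<close>.\<close>

definition monomial_end ::
    "int \<Rightarrow> ('v::ab_group_add \<Rightarrow> 'v) \<Rightarrow> (int \<Rightarrow>\<^sub>0 'v) \<Rightarrow> (int \<Rightarrow>\<^sub>0 'v)" where
  "monomial_end i g v = (\<Sum>j\<in>Poly_Mapping.keys v. Poly_Mapping.single (i + j) (g (Poly_Mapping.lookup v j)))"

text \<open>The coefficient \<open>\<phi>\<^sub>i\<close> in \<open>\<phi> = \<Sum>\<^sub>i t\<^sup>i \<phi>\<^sub>i\<close>; see \<open>end_decomposition\<close> and \<open>end_decomposition_unique\<close>.\<close>

definition end_coeff ::
    "((int \<Rightarrow>\<^sub>0 'v) \<Rightarrow> (int \<Rightarrow>\<^sub>0 'v)) \<Rightarrow> int \<Rightarrow> 'v::ab_group_add \<Rightarrow> 'v" where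
  "end_coeff \<phi> i u = Poly_Mapping.lookup (\<phi> (Poly_Mapping.single 0 u)) i"

definition specialize ::
    "((int \<Rightarrow>\<^sub>0 'v) \<Rightarrow> (int \<Rightarrow>\<^sub>0 'v)) \<Rightarrow> 'v::ab_group_add \<Rightarrow> 'v" where
  "specialize \<phi> u = Sum_any (\<lambda>i. end_coeff \<phi> i u)"

definition unitary_group ::
    "('k::field \<Rightarrow> 'v::ab_group_add \<Rightarrow> 'v) \<Rightarrow> ('v \<Rightarrow> 'v \<Rightarrow> 'k) \<Rightarrow> ('v \<Rightarrow> 'v) monoid" where
  "unitary_group scale b =
     \<lparr>carrier = {\<phi>. Vector_Spaces.linear scale scale \<phi> \<and> (\<forall>v w. b (\<phi> v) (\<phi> w) = b v w)},
      mult = (\<circ>), one = id\<rparr>"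

definition paraunitary_group ::
    "('k::field \<Rightarrow> 'v::ab_group_add \<Rightarrow> 'v) \<Rightarrow> ('v \<Rightarrow> 'v \<Rightarrow> 'k)
       \<Rightarrow> ((int \<Rightarrow>\<^sub>0 'v) \<Rightarrow> (int \<Rightarrow>\<^sub>0 'v)) monoid" where
  "paraunitary_group scale b =
     \<lparr>carrier = {\<phi>. module_hom (laurent_scale scale) (laurent_scale scale) \<phi> \<and> bij \<phi> \<and>
                    (\<forall>v w. laurent_form b (\<phi> v) (\<phi> w) = laurent_form b v w)},
      mult = (\<circ>), one = id\<rparr>"

definition pure_paraunitary ::
    "('k::field \<Rightarrow> 'v::ab_group_add \<Rightarrow> 'v) \<Rightarrow> ('v \<Rightarrow> 'v \<Rightarrow> 'k)
       \<Rightarrow> ((int \<Rightarrow>\<^sub>0 'v) \<Rightarrow> (int \<Rightarrow>\<^sub>0 'v)) set" where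
  "pure_paraunitary scale b =
     kernel (paraunitary_group scale b) (unitary_group scale b) specialize"

definition constant_unitary ::
    "('k::field \<Rightarrow> 'v::ab_group_add \<Rightarrow> 'v) \<Rightarrow> ('v \<Rightarrow> 'v \<Rightarrow> 'k)
       \<Rightarrow> ((int \<Rightarrow>\<^sub>0 'v) \<Rightarrow> (int \<Rightarrow>\<^sub>0 'v)) set" where
  "constant_unitary scale b = monomial_end 0 ` carrier (unitary_group scale b)"

definition internal_semidirect_product :: "('a, 'm) monoid_scheme \<Rightarrow> 'a set \<Rightarrow> 'a set \<Rightarrow> bool" where
  "internal_semidirect_product G N H \<longleftrightarrow>
     N \<lhd> G \<and> subgroup H G \<and> N \<inter> H = {\<one>\<^bsub>G\<^esub>} \<and> N <#>\<^bsub>G\<^esub> H = carrier G"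

lemma poly_mapping_sum_singles:
  "v = (\<Sum>j\<in>Poly_Mapping.keys v. Poly_Mapping.single j (Poly_Mapping.lookup v j))"
  by (rule poly_mapping_eqI) (simp add: lookup_sum lookup_single when_def in_keys_iff)

lemma poly_mapping_additive_induct [case_names single add]:
  assumes s: "\<And>i a. P (Poly_Mapping.single i a)" and a: "\<And>v w. P v \<Longrightarrow> P w \<Longrightarrow> P (v + w)"
  shows "P (v :: 'a \<Rightarrow>\<^sub>0 'b::comm_monoid_add)"
proof -
  have "finite I \<Longrightarrow> P (\<Sum>j\<in>I. Poly_Mapping.single j (g j))" for I g
  proof (induction I rule: finite_induct)
    case empty
    show ?case using s[of undefined 0] by simp
  qed (simp add: s a)
  then show ?thesis
    using poly_mapping_sum_singles[of v] by (metis finite_keys)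
qed

lemma laurent_scale_superset:
  assumes "vector_space scale" "finite I" "finite J"
    "Poly_Mapping.keys f \<subseteq> I" "Poly_Mapping.keys v \<subseteq> J"
  shows "laurent_scale scale f v =
     (\<Sum>i\<in>I. \<Sum>j\<in>J. Poly_Mapping.single (i + j) (scale (Poly_Mapping.lookup f i) (Poly_Mapping.lookup v j)))"
proof -
  interpret vector_space scale by fact
  have "(\<Sum>j\<in>J. Poly_Mapping.single (i + j) (scale (Poly_Mapping.lookup f i) (Poly_Mapping.lookup v j))) =
    (\<Sum>j\<in>Poly_Mapping.keys v. Poly_Mapping.single (i + j) (scale (Poly_Mapping.lookup f i) (Poly_Mapping.lookup v j)))" for i
    by (rule sum.mono_neutral_right) (use assms in \<open>auto simp: in_keys_iff\<close>)
  then have "(\<Sum>i\<in>I. \<Sum>j\<in>J. Poly_Mapping.single (i + j) (scale (Poly_Mapping.lookup f i) (Poly_Mapping.lookup v j)))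
    = (\<Sum>i\<in>I. \<Sum>j\<in>Poly_Mapping.keys v. Poly_Mapping.single (i + j) (scale (Poly_Mapping.lookup f i) (Poly_Mapping.lookup v j)))"
    by simp
  also have "\<dots> = laurent_scale scale f v"
    unfolding laurent_scale_def
    by (rule sum.mono_neutral_right) (use assms in \<open>auto simp: in_keys_iff\<close>)
  finally show ?thesis by simp
qed

lemma laurent_scale_single:
  assumes "vector_space scale"
  shows "laurent_scale scale (Poly_Mapping.single i a) (Poly_Mapping.single j u) =
    Poly_Mapping.single (i + j) (scale a u)"
  by (subst laurent_scale_superset[OF assms, of "{i}" "{j}"]) auto

lemma laurent_scale_add_left:
  assumes "vector_space scale"
  shows "laurent_scale scale (f + g) v = laurent_scale scale f v + laurent_scale scale g v"
proof -
  interpret vector_space scale by fact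
  let ?I = "Poly_Mapping.keys f \<union> Poly_Mapping.keys g" and ?J = "Poly_Mapping.keys v"
  show ?thesis
    using keys_add[of f g]
    by (simp add: laurent_scale_superset[OF assms, of ?I ?J] lookup_add scale_left_distrib
        single_add sum.distrib)
qed

lemma laurent_scale_add_right:
  assumes "vector_space scale"
  shows "laurent_scale scale f (v + w) = laurent_scale scale f v + laurent_scale scale f w"
proof -
  interpret vector_space scale by fact
  let ?I = "Poly_Mapping.keys f" and ?J = "Poly_Mapping.keys v \<union> Poly_Mapping.keys w"
  show ?thesis
    using keys_add[of v w]
    by (simp add: laurent_scale_superset[OF assms, of ?I ?J] lookup_add scale_right_distrib
        single_add sum.distrib)
qed

lemma module_laurent_scale:
  assumes "vector_space scale"
  shows "module (laurent_scale scale)"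
proof
  interpret vector_space scale by fact
  note add = laurent_scale_add_left[OF assms] laurent_scale_add_right[OF assms]
  fix f g v w
  show "laurent_scale scale f (v + w) = laurent_scale scale f v + laurent_scale scale f w"
    and "laurent_scale scale (f + g) v = laurent_scale scale f v + laurent_scale scale g v"
    by (rule add)+
  show "laurent_scale scale f (laurent_scale scale g v) = laurent_scale scale (f * g) v"
  proof (induction f rule: poly_mapping_additive_induct)
    case (single i a)
    show ?case
    proof (induction g rule: poly_mapping_additive_induct)
      case (single j c)
      show ?case
        by (induction v rule: poly_mapping_additive_induct)
          (simp_all add: laurent_scale_single[OF assms] mult_single add add.assoc)
    qed (simp add: add distrib_left)
  qed (simp add: add distrib_right)
  show "laurent_scale scale 1 v = v"
    by (induction v rule: poly_mapping_additive_induct)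
      (simp_all add: laurent_scale_single[OF assms] add flip: single_one)
qed

lemma lookup_laurent_form:
  assumes z: "\<And>u. b 0 u = 0" "\<And>u. b u 0 = 0"
  shows "finite {i. b (Poly_Mapping.lookup v (i - n)) (Poly_Mapping.lookup w i) \<noteq> 0}"
    and "Poly_Mapping.lookup (laurent_form b v w) n =
      Sum_any (\<lambda>i. b (Poly_Mapping.lookup v (i - n)) (Poly_Mapping.lookup w i))"
proof -
  let ?g = "\<lambda>n. Sum_any (\<lambda>i. b (Poly_Mapping.lookup v (i - n)) (Poly_Mapping.lookup w i))"
  show "finite {i. b (Poly_Mapping.lookup v (i - n)) (Poly_Mapping.lookup w i) \<noteq> 0}"
    by (rule finite_subset[of _ "Poly_Mapping.keys w"]) (auto simp: in_keys_iff z)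
  let ?S = "(\<lambda>(i, j). i - j) ` (Poly_Mapping.keys w \<times> Poly_Mapping.keys v)"
  have g: "?g m = 0" if "m \<notin> ?S" for m
  proof -
    have "b (Poly_Mapping.lookup v (i - m)) (Poly_Mapping.lookup w i) = 0" for i
    proof (rule ccontr)
      assume "\<not> ?thesis"
      then have "i \<in> Poly_Mapping.keys w" "i - m \<in> Poly_Mapping.keys v"
        by (auto simp: in_keys_iff z)
      then have "m \<in> ?S" by (intro image_eqI[of _ _ "(i, i - m)"]) auto
      with that show False by blast
    qed
    then show ?thesis by simp
  qed
  have "laurent_form b v w = (\<Sum>m\<in>?S. Poly_Mapping.single m (?g m))"
    unfolding laurent_form_def
    by (rule Sum_any.expand_superset) (use g in force)+
  then have "Poly_Mapping.lookup (laurent_form b v w) n = (\<Sum>m\<in>?S. (?g m when m = n))"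
    by (simp add: lookup_sum lookup_single)
  also have "\<dots> = ?g n"
  proof (cases "n \<in> ?S")
    case True
    have "(\<Sum>m\<in>?S. (?g m when m = n)) = (\<Sum>m\<in>{n}. (?g m when m = n))"
      by (rule sum.mono_neutral_right) (use True in \<open>auto simp: when_def\<close>)
    then show ?thesis by simp
  next
    case False
    have "(\<Sum>m\<in>?S. (?g m when m = n)) = 0"
      by (rule sum.neutral) (use False in \<open>auto simp: when_def\<close>)
    then show ?thesis using g[OF False] by simp
  qed
  finally show "Poly_Mapping.lookup (laurent_form b v w) n = ?g n" .
qed

lemma monomial_end_superset:
  assumes "g 0 = 0" "finite J" "Poly_Mapping.keys v \<subseteq> J"
  shows "monomial_end i g v = (\<Sum>j\<in>J. Poly_Mapping.single (i + j) (g (Poly_Mapping.lookup v j)))"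
  unfolding monomial_end_def
  by (rule sum.mono_neutral_left) (use assms in \<open>auto simp: in_keys_iff\<close>)

lemma monomial_end_single:
  assumes "g 0 = 0"
  shows "monomial_end i g (Poly_Mapping.single j u) = Poly_Mapping.single (i + j) (g u)"
  by (subst monomial_end_superset[where J = "{j}"]) (auto simp: assms)

lemma monomial_end_add:
  assumes "\<And>u w. g (u + w) = g u + g w" "g 0 = 0"
  shows "monomial_end i g (v + w) = monomial_end i g v + monomial_end i g w"
  using keys_add[of v w]
  by (simp add: monomial_end_superset[where J = "Poly_Mapping.keys v \<union> Poly_Mapping.keys w"]
      lookup_add assms single_add sum.distrib)

context finite_dimensional_vector_space
begin

lemma linear_end_coeff:
  assumes "module_hom (laurent_scale scale) (laurent_scale scale) \<phi>"
  shows "Vector_Spaces.linear scale scale (end_coeff \<phi> i)"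
proof -
  interpret h: module_hom "laurent_scale scale" "laurent_scale scale" \<phi> by fact
  have V: "vector_space scale" by (rule vector_space_axioms)
  have l: "Poly_Mapping.lookup (laurent_scale scale (Poly_Mapping.single 0 a) v) i = scale a (Poly_Mapping.lookup v i)" for a v
    by (induction v rule: poly_mapping_additive_induct)
      (simp_all add: laurent_scale_single[OF V] lookup_single when_def laurent_scale_add_right[OF V]
         lookup_add scale_right_distrib)
  show ?thesis
  proof (rule Vector_Spaces.linear.intro)
    show "module_hom scale scale (end_coeff \<phi> i)"
    proof
      show "end_coeff \<phi> i (u + w) = end_coeff \<phi> i u + end_coeff \<phi> i w" for u w
        by (simp add: end_coeff_def single_add h.add lookup_add)
      show "end_coeff \<phi> i (scale a u) = scale a (end_coeff \<phi> i u)" for a u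
        using h.scale[of "Poly_Mapping.single 0 a" "Poly_Mapping.single 0 u"]
        by (simp add: end_coeff_def laurent_scale_single[OF V] l)
    qed
  qed (rule V)+
qed

lemma end_decomposition:
  assumes "module_hom (laurent_scale scale) (laurent_scale scale) \<phi>"
  shows "finite {i. end_coeff \<phi> i \<noteq> (\<lambda>_. 0)}" (is "finite ?S")
    and "\<phi> v = (\<Sum>i | end_coeff \<phi> i \<noteq> (\<lambda>_. 0). monomial_end i (end_coeff \<phi> i) v)"
proof -
  interpret h: module_hom "laurent_scale scale" "laurent_scale scale" \<phi> by fact
  have V: "vector_space scale" by (rule vector_space_axioms)
  note lin = linear_end_coeff[OF assms]
  have z: "end_coeff \<phi> i 0 = 0" for i
    by (simp add: end_coeff_def h.zero)
  have ad: "end_coeff \<phi> i (u + w) = end_coeff \<phi> i u + end_coeff \<phi> i w" for i u w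
    by (simp add: end_coeff_def single_add h.add lookup_add)
  have "?S \<subseteq> (\<Union>e\<in>Basis. Poly_Mapping.keys (\<phi> (Poly_Mapping.single 0 e)))"
  proof
    fix i assume i: "i \<in> ?S"
    show "i \<in> (\<Union>e\<in>Basis. Poly_Mapping.keys (\<phi> (Poly_Mapping.single 0 e)))"
    proof (rule ccontr)
      assume "\<not> ?thesis"
      then have e: "end_coeff \<phi> i e = 0" if "e \<in> Basis" for e
        using that by (auto simp: end_coeff_def in_keys_iff)
      interpret c: Vector_Spaces.linear scale scale "end_coeff \<phi> i" by (rule lin)
      have "end_coeff \<phi> i u = 0" for u
        by (rule c.eq_0_on_span[of Basis]) (simp_all add: e span_Basis)
      then show False using i by auto
    qed
  qed
  then show fin: "finite ?S"
    by (rule finite_subset) (simp add: finite_Basis)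
  show "\<phi> v = (\<Sum>i\<in>?S. monomial_end i (end_coeff \<phi> i) v)"
  proof (induction v rule: poly_mapping_additive_induct)
    case (single j u)
    have "\<phi> (Poly_Mapping.single 0 u) = (\<Sum>i\<in>?S. Poly_Mapping.single i (end_coeff \<phi> i u))"
    proof (rule poly_mapping_eqI)
      fix k
      have "(\<Sum>i\<in>?S. (end_coeff \<phi> i u when i = k)) = end_coeff \<phi> k u"
      proof (cases "k \<in> ?S")
        case True
        have "(\<Sum>i\<in>?S. (end_coeff \<phi> i u when i = k)) = (\<Sum>i\<in>{k}. (end_coeff \<phi> i u when i = k))"
          by (rule sum.mono_neutral_right) (use True fin in \<open>auto simp: when_def\<close>)
        then show ?thesis by simp
      next
        case False
        have "(\<Sum>i\<in>?S. (end_coeff \<phi> i u when i = k)) = 0"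
          by (rule sum.neutral) (use False in \<open>auto simp: when_def\<close>)
        then show ?thesis using False by simp
      qed
      then show "Poly_Mapping.lookup (\<phi> (Poly_Mapping.single 0 u)) k = Poly_Mapping.lookup (\<Sum>i\<in>?S. Poly_Mapping.single i (end_coeff \<phi> i u)) k"
        by (simp add: lookup_sum lookup_single end_coeff_def)
    qed
    then have "laurent_scale scale (Poly_Mapping.single j 1) (\<phi> (Poly_Mapping.single 0 u)) =
      (\<Sum>i\<in>?S. Poly_Mapping.single (j + i) (end_coeff \<phi> i u))"
      by (simp add: module.scale_sum_right[OF module_laurent_scale[OF V]] laurent_scale_single[OF V])
    then show ?case
      using h.scale[of "Poly_Mapping.single j 1" "Poly_Mapping.single 0 u"]
      by (simp add: laurent_scale_single[OF V] monomial_end_single z add.commute)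
  qed (simp add: h.add monomial_end_add ad z sum.distrib)
qed

end

lemma end_decomposition_unique:
  assumes "finite I" "\<And>i. i \<in> I \<Longrightarrow> g i 0 = 0"
    and "\<And>v. \<phi> v = (\<Sum>i\<in>I. monomial_end i (g i) v)"
  shows "end_coeff \<phi> i u = (if i \<in> I then g i u else 0)"
proof -
  have "end_coeff \<phi> i u = (\<Sum>j\<in>I. (g j u when j = i))"
    using assms(2) by (simp add: end_coeff_def assms(3) lookup_sum monomial_end_single lookup_single)
  also have "\<dots> = (\<Sum>j\<in>I. if j = i then g j u else 0)"
    by (simp add: when_def)
  finally show ?thesis by (simp add: assms(1))
qed

end

theory Submission
  imports Defs
begin

text \<open>
  Setting \<open>t = 1\<close> is a ring homomorphism from the Laurent polynomials to \<open>k\<close> and a compatible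
  map \<open>V[t,t\<inverse>] \<rightarrow> V\<close>. It carries the form on the Laurent module to \<open>b\<close> and intertwines \<open>\<phi>\<close>
  with its specialization, so specialization is a homomorphism into \<open>U(b)\<close>. The inclusion of the
  constants is a section of it, and a split homomorphism yields a semidirect product.
  Anisotropy and finite dimension are needed only to see that \<open>U(b)\<close> is a group: isometries are
  injective, hence bijective.
\<close>

section \<open>Split homomorphisms of groups\<close>

text \<open>If \<open>x = s h\<close> lies in the kernel, then \<open>h = p x\<close> is trivial,
  hence so is \<open>x\<close>. The isomorphism onto the image of \<open>s\<close> makes precise the
  identification of a group with its copy inside \<open>G\<close>.\<close>

lemma split_hom_semidirect:
  assumes "group G" "group H" and p: "p \<in> hom G H" and s: "s \<in> hom H G"
    and ps: "\<And>x. x \<in> carrier H \<Longrightarrow> p (s x) = x"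
  shows "s \<in> iso H (G\<lparr>carrier := s ` carrier H\<rparr>)"
    and "internal_semidirect_product G (kernel G H p) (s ` carrier H)"
proof -
  interpret G: group G by fact
  interpret H: group H by fact
  interpret p: group_hom G H p using p by unfold_locales
  interpret s: group_hom H G s using s by unfold_locales
  have "inj_on s (carrier H)"
    by (metis inj_onI ps)
  then show "s \<in> iso H (G\<lparr>carrier := s ` carrier H\<rparr>)"
    by (auto simp: iso_def hom_def bij_betw_def)
  have "x = \<one>\<^bsub>G\<^esub>" if "x \<in> kernel G H p" "x \<in> s ` carrier H" for x
    using that ps s.hom_one by (metis (mono_tags, lifting) imageE kernel_def mem_Collect_eq)
  moreover have "\<one>\<^bsub>G\<^esub> \<in> kernel G H p"
    by (simp add: kernel_def)
  moreover have "\<one>\<^bsub>G\<^esub> \<in> s ` carrier H"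
    using s.hom_one H.one_closed by (rule image_eqI[OF sym])
  ultimately have "kernel G H p \<inter> s ` carrier H = {\<one>\<^bsub>G\<^esub>}"
    by blast
  moreover have "kernel G H p <#>\<^bsub>G\<^esub> s ` carrier H = carrier G"
  proof
    show "kernel G H p <#>\<^bsub>G\<^esub> s ` carrier H \<subseteq> carrier G"
      by (auto simp: set_mult_def kernel_def)
    show "carrier G \<subseteq> kernel G H p <#>\<^bsub>G\<^esub> s ` carrier H"
    proof
      fix x assume x: "x \<in> carrier G"
      \<comment> \<open>The kernel factor of \<open>x\<close>: since
        \<open>p (s (p x)) = p x\<close>, dividing by \<open>s (p x)\<close> makes the image under
        \<open>p\<close> trivial.\<close>
      have "x \<otimes>\<^bsub>G\<^esub> inv\<^bsub>G\<^esub> s (p x) \<in> kernel G H p"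
        using x by (simp add: kernel_def ps)
      moreover have "s (p x) \<in> s ` carrier H"
        using x by simp
      ultimately have "x \<otimes>\<^bsub>G\<^esub> inv\<^bsub>G\<^esub> s (p x) \<otimes>\<^bsub>G\<^esub> s (p x) \<in> kernel G H p <#>\<^bsub>G\<^esub> s ` carrier H"
        unfolding set_mult_def by blast
      then show "x \<in> kernel G H p <#>\<^bsub>G\<^esub> s ` carrier H"
        using x by (simp add: G.m_assoc)
    qed
  qed
  ultimately show "internal_semidirect_product G (kernel G H p) (s ` carrier H)"
    by (simp add: internal_semidirect_product_def p.normal_kernel s.img_is_subgroup)
qed

section \<open>Evaluation at \<open>t = 1\<close>\<close>

text \<open>The polymorphic type lets one map serve both Laurent polynomials and the Laurent module.
  Coefficients have finite support, so \<open>Sum_any\<close> is the true sum and never its default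
  \<open>0\<close>.\<close>

definition eval_one :: "(int \<Rightarrow>\<^sub>0 'a) \<Rightarrow> 'a::comm_monoid_add" where
  "eval_one v = Sum_any (Poly_Mapping.lookup v)"

lemma eval_one_single [simp]: "eval_one (Poly_Mapping.single i u) = u"
  by (simp add: eval_one_def lookup_single)

lemma eval_one_add [simp]: "eval_one (v + w) = eval_one v + eval_one w"
  by (simp add: eval_one_def lookup_add Sum_any.distrib)

lemma eval_one_laurent_scale:
  assumes "vector_space scale"
  shows "eval_one (laurent_scale scale f v) = scale (eval_one f) (eval_one v)"
proof -
  interpret vector_space scale by fact
  show ?thesis
  proof (induction f rule: poly_mapping_additive_induct)
    case (single i a)
    show ?case
      by (induction v rule: poly_mapping_additive_induct)
        (simp_all add: laurent_scale_single[OF assms] laurent_scale_add_right[OF assms] scale_right_distrib)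
  qed (simp add: laurent_scale_add_left[OF assms] scale_left_distrib)
qed

lemma specialize_eq_eval_one: "specialize \<phi> u = eval_one (\<phi> (Poly_Mapping.single 0 u))"
  by (simp add: specialize_def eval_one_def end_coeff_def)

text \<open>By additivity \<open>v\<close> may be taken to be \<open>t^j u\<close>. There \<phi>
  commutes with multiplication by \<open>t^j\<close>, which evaluates to \<open>1\<close>. This is
  what makes specialization multiplicative.\<close>

lemma eval_one_module_hom:
  assumes V: "vector_space scale" and "module_hom (laurent_scale scale) (laurent_scale scale) \<phi>"
  shows "eval_one (\<phi> v) = specialize \<phi> (eval_one v)"
proof -
  interpret vector_space scale by fact
  interpret h: module_hom "laurent_scale scale" "laurent_scale scale" \<phi> by fact
  show ?thesis
  proof (induction v rule: poly_mapping_additive_induct)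
    case (single j u)
    then show ?case
      using h.scale[of "Poly_Mapping.single j 1" "Poly_Mapping.single 0 u"]
      by (simp add: laurent_scale_single[OF V] eval_one_laurent_scale[OF V] specialize_eq_eval_one)
  qed (simp add: specialize_eq_eval_one single_add h.add)
qed

section \<open>The Laurent form on monomials and at \<open>t = 1\<close>\<close>

locale biadditive =
  fixes b :: "'v::ab_group_add \<Rightarrow> 'v \<Rightarrow> 'k::field"
  assumes add_left: "b (u + v) w = b u w + b v w"
    and add_right: "b u (v + w) = b u v + b u w"
begin

lemma zero_left [simp]: "b 0 w = 0"
  by (metis add_left add.right_neutral add_left_cancel)

lemma zero_right [simp]: "b u 0 = 0"
  by (metis add_right add.right_neutral add_left_cancel)

lemma laurent_form_add_left: "laurent_form b (u + v) w = laurent_form b u w + laurent_form b v w"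
  by (rule poly_mapping_eqI)
    (simp add: lookup_laurent_form lookup_add add_left Sum_any.distrib)

lemma laurent_form_add_right: "laurent_form b u (v + w) = laurent_form b u v + laurent_form b u w"
  by (rule poly_mapping_eqI)
    (simp add: lookup_laurent_form lookup_add add_right Sum_any.distrib)

text \<open>The exponent is a difference because the Laurent form is sesquilinear for the involution
  sending \<open>t\<close> to its inverse.\<close>

lemma laurent_form_single:
  "laurent_form b (Poly_Mapping.single i u) (Poly_Mapping.single j w) =
    Poly_Mapping.single (j - i) (b u w)"
proof (rule poly_mapping_eqI)
  fix n
  \<comment> \<open>Only the summand at \<open>m = j\<close> can survive, and there the first
    argument is \<open>u\<close> exactly when \<open>j - i = n\<close>. The outer guard on
    \<open>m\<close> lets the infinite sum collapse.\<close>
  have "(\<lambda>m. b (u when i = m - n) (w when j = m)) = (\<lambda>m. (b u w when j - i = n) when j = m)"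
    by (auto simp: when_def fun_eq_iff)
  then show "Poly_Mapping.lookup (laurent_form b (Poly_Mapping.single i u) (Poly_Mapping.single j w)) n =
      Poly_Mapping.lookup (Poly_Mapping.single (j - i) (b u w)) n"
    by (simp only: lookup_laurent_form zero_left zero_right lookup_single Sum_any_when_equal')
qed

text \<open>Biadditivity reduces this to monomials, where every power of \<open>t\<close> becomes
  \<open>1\<close>, so the involution on \<open>t\<close> leaves no trace.\<close>

lemma eval_one_laurent_form: "eval_one (laurent_form b v w) = b (eval_one v) (eval_one w)"
proof (induction v rule: poly_mapping_additive_induct)
  case (single i u)
  show ?case
    by (induction w rule: poly_mapping_additive_induct)
      (simp_all add: laurent_form_single laurent_form_add_right add_right)
qed (simp add: laurent_form_add_left add_left)

text \<open>On monomials the shift by \<open>i\<close> occurs in both arguments and cancels in the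
  difference of exponents; the isometry \<open>g\<close> handles the coefficients.\<close>

lemma laurent_form_monomial_end:
  assumes add: "\<And>u w. g (u + w) = g u + g w" and isom: "\<And>u w. b (g u) (g w) = b u w"
  shows "laurent_form b (monomial_end i g v) (monomial_end i g w) = laurent_form b v w"
proof -
  have z: "g 0 = 0" using add[of 0 0] by simp
  show ?thesis
  proof (induction v rule: poly_mapping_additive_induct)
    case (single j u)
    show ?case
      by (induction w rule: poly_mapping_additive_induct)
        (simp_all add: monomial_end_single monomial_end_add laurent_form_single
          laurent_form_add_right add z isom)
  qed (simp add: monomial_end_add laurent_form_add_left add z)
qed

end

section \<open>Monomial endomorphisms\<close>

lemma monomial_end_comp:
  assumes g: "\<And>u w. g (u + w) = g u + g w" "g 0 = 0" and h: "\<And>u w. h (u + w) = h u + h w" "h 0 = 0"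
  shows "monomial_end i g (monomial_end j h v) = monomial_end (i + j) (g \<circ> h) v"
  by (induction v rule: poly_mapping_additive_induct)
    (simp_all add: monomial_end_single monomial_end_add g h add.assoc)

lemma monomial_end_id: "monomial_end 0 id v = v"
  by (induction v rule: poly_mapping_additive_induct)
    (simp_all add: monomial_end_single monomial_end_add)

lemma specialize_monomial_end:
  assumes "g 0 = 0"
  shows "specialize (monomial_end i g) = g"
  by (simp add: fun_eq_iff specialize_eq_eval_one monomial_end_single assms)

lemma module_hom_monomial_end:
  assumes V: "vector_space scale" and "Vector_Spaces.linear scale scale g"
  shows "module_hom (laurent_scale scale) (laurent_scale scale) (monomial_end i g)"
proof -
  interpret g: Vector_Spaces.linear scale scale g by fact
  interpret L: module "laurent_scale scale" by (rule module_laurent_scale[OF V])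
  show ?thesis
  proof
    fix f v w
    show "monomial_end i g (v + w) = monomial_end i g v + monomial_end i g w"
      by (simp add: monomial_end_add g.add g.zero)
    show "monomial_end i g (laurent_scale scale f v) = laurent_scale scale f (monomial_end i g v)"
    proof (induction f rule: poly_mapping_additive_induct)
      case (single j a)
      show ?case
        by (induction v rule: poly_mapping_additive_induct)
          (simp_all add: laurent_scale_single[OF V] laurent_scale_add_right[OF V] monomial_end_single
            monomial_end_add g.add g.zero g.scale add.left_commute)
    qed (simp add: laurent_scale_add_left[OF V] monomial_end_add g.add g.zero)
  qed
qed

section \<open>The paraunitary group\<close>

lemma group_paraunitary_group:
  assumes "vector_space scale"
  shows "group (paraunitary_group scale b)"
proof (rule groupI)
  interpret L: module "laurent_scale scale" by (rule module_laurent_scale[OF assms])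
  show "\<one>\<^bsub>paraunitary_group scale b\<^esub> \<in> carrier (paraunitary_group scale b)"
    by (simp add: paraunitary_group_def L.module_hom_id)
  show "\<phi> \<otimes>\<^bsub>paraunitary_group scale b\<^esub> \<psi> \<in> carrier (paraunitary_group scale b)"
    if "\<phi> \<in> carrier (paraunitary_group scale b)" "\<psi> \<in> carrier (paraunitary_group scale b)" for \<phi> \<psi>
    using that by (auto simp: paraunitary_group_def intro: module_hom_compose bij_comp)
  fix \<phi> assume "\<phi> \<in> carrier (paraunitary_group scale b)"
  then have hom: "module_hom (laurent_scale scale) (laurent_scale scale) \<phi>" and bij: "bij \<phi>"
    and isom: "\<And>v w. laurent_form b (\<phi> v) (\<phi> w) = laurent_form b v w"
    by (auto simp: paraunitary_group_def)
  interpret h: module_hom "laurent_scale scale" "laurent_scale scale" \<phi> by fact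
  have \<phi>inv: "\<phi> (inv_into UNIV \<phi> v) = v" for v
    using bij by (simp add: bij_is_surj surj_f_inv_f)
  \<comment> \<open>Linearity of the inverse: both sides of each law have the same image under the
    injective map \<phi>.\<close>
  have "module_hom (laurent_scale scale) (laurent_scale scale) (inv_into UNIV \<phi>)"
    by unfold_locales (metis \<phi>inv bij bij_is_inj h.add h.scale inv_f_eq)+
  moreover have "laurent_form b (inv_into UNIV \<phi> v) (inv_into UNIV \<phi> w) = laurent_form b v w" for v w
    using isom[of "inv_into UNIV \<phi> v" "inv_into UNIV \<phi> w"] by (simp add: \<phi>inv)
  ultimately show "\<exists>\<psi>\<in>carrier (paraunitary_group scale b).
      \<psi> \<otimes>\<^bsub>paraunitary_group scale b\<^esub> \<phi> = \<one>\<^bsub>paraunitary_group scale b\<^esub>"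
    using bij by (auto simp: paraunitary_group_def bij_imp_bij_inv bij_is_inj intro!: bexI[of _ "inv_into UNIV \<phi>"])
qed (auto simp: paraunitary_group_def)

section \<open>The unitary group of an anisotropic form\<close>

locale anisotropic_space = finite_dimensional_vector_space scale Basis + biadditive b
  for scale :: "'k::field \<Rightarrow> 'v::ab_group_add \<Rightarrow> 'v" and Basis and b :: "'v \<Rightarrow> 'v \<Rightarrow> 'k" +
  assumes anisotropic: "b v v = 0 \<longleftrightarrow> v = 0"
begin

lemma unitaryD:
  assumes "g \<in> carrier (unitary_group scale b)"
  shows "Vector_Spaces.linear scale scale g" "b (g u) (g w) = b u w"
    "g (u + w) = g u + g w" "g 0 = 0"
proof -
  show lin: "Vector_Spaces.linear scale scale g" and "b (g u) (g w) = b u w"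
    using assms by (auto simp: unitary_group_def)
  interpret g: Vector_Spaces.linear scale scale g by fact
  show "g (u + w) = g u + g w" "g 0 = 0" by (rule g.add g.zero)+
qed

text \<open>Bijectivity is not part of the carrier, so it has to be derived: \<open>g u = 0\<close>
  forces \<open>b u u = 0\<close>, hence \<open>u = 0\<close>, and an injective endomorphism in
  finite dimension is surjective.\<close>

lemma unitary_inverse:
  assumes g: "g \<in> carrier (unitary_group scale b)"
  obtains h where "h \<in> carrier (unitary_group scale b)" "h \<circ> g = id" "g \<circ> h = id"
proof -
  interpret g: Vector_Spaces.linear scale scale g by (rule unitaryD[OF g])
  have "u = 0" if "g u = 0" for u
    using unitaryD(2)[OF g, of u u] that by (simp add: anisotropic)
  then have "inj g" by (auto simp: g.inj_iff_eq_0)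
  moreover have "surj g"
    by (rule linear_inj_imp_surj[OF g.linear_axioms \<open>inj g\<close>])
  ultimately have bij: "bij g" by (rule bijI)
  then have ginv: "g (inv_into UNIV g v) = v" for v
    by (simp add: bij_is_surj surj_f_inv_f)
  have "Vector_Spaces.linear scale scale (inv_into UNIV g)"
    by unfold_locales (metis ginv \<open>inj g\<close> g.add g.scale inv_f_eq)+
  moreover have "b (inv_into UNIV g v) (inv_into UNIV g w) = b v w" for v w
    using unitaryD(2)[OF g, of "inv_into UNIV g v" "inv_into UNIV g w"] by (simp add: ginv)
  ultimately have "inv_into UNIV g \<in> carrier (unitary_group scale b)"
    by (simp add: unitary_group_def)
  then show thesis
    using bij by (intro that[of "inv_into UNIV g"]) (simp_all add: fun_eq_iff ginv \<open>inj g\<close>)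
qed

lemma group_unitary_group: "group (unitary_group scale b)"
proof (rule groupI)
  show "\<one>\<^bsub>unitary_group scale b\<^esub> \<in> carrier (unitary_group scale b)"
    by (simp add: unitary_group_def linear_id)
  show "g \<otimes>\<^bsub>unitary_group scale b\<^esub> h \<in> carrier (unitary_group scale b)"
    if "g \<in> carrier (unitary_group scale b)" "h \<in> carrier (unitary_group scale b)" for g h
    using that Vector_Spaces.linear_compose[of scale scale h scale g] by (simp add: unitary_group_def)
  show "\<exists>h\<in>carrier (unitary_group scale b). h \<otimes>\<^bsub>unitary_group scale b\<^esub> g = \<one>\<^bsub>unitary_group scale b\<^esub>"
    if "g \<in> carrier (unitary_group scale b)" for g
    by (rule unitary_inverse[OF that], rule bexI) (simp_all add: unitary_group_def)
qed (auto simp: unitary_group_def)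

section \<open>Specialization and its section\<close>

lemma specialize_hom: "specialize \<in> hom (paraunitary_group scale b) (unitary_group scale b)"
proof (rule homI)
  have V: "vector_space scale" by (rule vector_space_axioms)
  fix \<phi> assume "\<phi> \<in> carrier (paraunitary_group scale b)"
  then have hom: "module_hom (laurent_scale scale) (laurent_scale scale) \<phi>"
    and isom: "\<And>v w. laurent_form b (\<phi> v) (\<phi> w) = laurent_form b v w"
    by (auto simp: paraunitary_group_def)
  interpret h: module_hom "laurent_scale scale" "laurent_scale scale" \<phi> by fact
  have "Vector_Spaces.linear scale scale (specialize \<phi>)"
  proof unfold_locales
    show "specialize \<phi> (u + w) = specialize \<phi> u + specialize \<phi> w" for u w
      by (simp add: specialize_eq_eval_one single_add h.add)
    show "specialize \<phi> (scale a u) = scale a (specialize \<phi> u)" for a u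
      using h.scale[of "Poly_Mapping.single 0 a" "Poly_Mapping.single 0 u"]
      by (simp add: specialize_eq_eval_one laurent_scale_single[OF V] eval_one_laurent_scale[OF V])
  qed
  moreover have "b (specialize \<phi> u) (specialize \<phi> w) = b u w" for u w
    \<comment> \<open>The evaluation rule is used in both directions: first to pull \<open>b\<close>
      back to the Laurent form, where \<phi> drops out, then to return to \<open>b\<close> on the
      constants \<open>u\<close> and \<open>w\<close>.\<close>
    unfolding specialize_eq_eval_one by (simp add: isom flip: eval_one_laurent_form)
      (simp add: eval_one_laurent_form)
  ultimately show "specialize \<phi> \<in> carrier (unitary_group scale b)"
    by (simp add: unitary_group_def)
  \<comment> \<open>Multiplicativity is the intertwining law for \<phi> at the vector
    \<open>\<psi> (single 0 u)\<close>, whose evaluation is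
    \<open>specialize \<psi> u\<close>.\<close>
  fix \<psi>
  have "specialize (\<phi> \<circ> \<psi>) u = specialize \<phi> (specialize \<psi> u)" for u
    using eval_one_module_hom[OF V hom] by (simp add: specialize_eq_eval_one)
  then show "specialize (\<phi> \<otimes>\<^bsub>paraunitary_group scale b\<^esub> \<psi>) =
      specialize \<phi> \<otimes>\<^bsub>unitary_group scale b\<^esub> specialize \<psi>"
    by (auto simp: paraunitary_group_def unitary_group_def)
qed

lemma monomial_end_hom: "monomial_end 0 \<in> hom (unitary_group scale b) (paraunitary_group scale b)"
proof (rule homI)
  have comp: "monomial_end 0 g \<circ> monomial_end 0 h = monomial_end 0 (g \<circ> h)"
    if "g \<in> carrier (unitary_group scale b)" "h \<in> carrier (unitary_group scale b)" for g h
    using that by (auto simp: monomial_end_comp unitaryD)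
  fix g assume g: "g \<in> carrier (unitary_group scale b)"
  show "monomial_end 0 (g \<otimes>\<^bsub>unitary_group scale b\<^esub> h) =
      monomial_end 0 g \<otimes>\<^bsub>paraunitary_group scale b\<^esub> monomial_end 0 h"
    if "h \<in> carrier (unitary_group scale b)" for h
    using comp[OF g that] by (simp add: paraunitary_group_def unitary_group_def)
  \<comment> \<open>The constant endomorphism given by \<open>h\<close> is a two-sided inverse of
    the one given by \<open>g\<close>, which yields the bijectivity demanded by the paraunitary
    carrier.\<close>
  obtain h where h: "h \<in> carrier (unitary_group scale b)" "h \<circ> g = id" "g \<circ> h = id"
    by (rule unitary_inverse[OF g])
  have "monomial_end 0 id = (id :: (int \<Rightarrow>\<^sub>0 'v) \<Rightarrow> _)"
    by (auto simp: monomial_end_id)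
  with h have "bij (monomial_end 0 g)"
    by (metis comp g o_bij)
  then show "monomial_end 0 g \<in> carrier (paraunitary_group scale b)"
    by (simp add: paraunitary_group_def module_hom_monomial_end vector_space_axioms
        laurent_form_monomial_end unitaryD[OF g])
qed

end

theorem corollary2:
  fixes scale :: "'k::field \<Rightarrow> 'v::ab_group_add \<Rightarrow> 'v"
    and Basis :: "'v set"
    and b :: "'v \<Rightarrow> 'v \<Rightarrow> 'k"
  assumes "finite_dimensional_vector_space scale Basis"
    and "\<And>v. Vector_Spaces.linear scale (*) (\<lambda>w. b v w)"
    and "\<And>w. Vector_Spaces.linear scale (*) (\<lambda>v. b v w)"
    and "\<And>v w. b v w = b w v"
    and "\<And>v. b v v = 0 \<longleftrightarrow> v = 0"
  shows "specialize \<in> hom (paraunitary_group scale b) (unitary_group scale b)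
    \<and> monomial_end 0 \<in> iso (unitary_group scale b)
           ((paraunitary_group scale b)\<lparr>carrier := constant_unitary scale b\<rparr>)
    \<and> internal_semidirect_product (paraunitary_group scale b)
           (pure_paraunitary scale b) (constant_unitary scale b)"
proof -
  interpret finite_dimensional_vector_space scale Basis by fact
  interpret anisotropic_space scale Basis b
  proof unfold_locales
    show "b (u + v) w = b u w + b v w" for u v w
      using assms(3)[of w] by (simp add: linear_iff_module_hom module_hom_iff)
    show "b u (v + w) = b u v + b u w" for u v w
      using assms(2)[of u] by (simp add: linear_iff_module_hom module_hom_iff)
  qed (rule assms(5))
  \<comment> \<open>Here \<open>p\<close> is \<open>specialize\<close> and \<open>s\<close> is
    \<open>monomial_end 0\<close>. The premise that \<open>p\<close> undoes \<open>s\<close> stays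
    open and is settled at the end by \<open>specialize_monomial_end\<close>.\<close>
  note semidirect = split_hom_semidirect[OF group_paraunitary_group[OF vector_space_axioms]
      group_unitary_group specialize_hom monomial_end_hom]
  show ?thesis
    unfolding pure_paraunitary_def constant_unitary_def
    by (intro conjI specialize_hom semidirect) (simp_all add: specialize_monomial_end unitaryD(4))
qed

end
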